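(* Let $n\geq 4$ be an integer. If $\Delta^o(A_n)^*$ is connected, then $\operatorname{diam}(\Delta^o(A_n)^* )\leq 3$.
   Context: $A_n$ is the alternating group of degree $n$. For a finite group $G$, $o(g)$ denotes the order of $g\in G$, and the order super commuting graph $\Delta^o(G)$ is the simple undirected graph with vertex set $G$ in which two distinct elements $g,h$ are adjacent iff either $o(g)=o(h)$, or there exist $g',h'\in G$ with $o(g')=o(g)$, $o(h')=o(h)$ such that $g'$ and $h'$ are distinct and commute. A vertex is dominant if it is adjacent to every other vertex. The reduced order super commuting graph $\Delta^o(G)^*$ is the induced subgraph of $\Delta^o(G)$ obtained by deleting all dominant vertices of $\Delta^o(G)$. The diameter $\operatorname{diam}$ of a connected graph is the maximum distance between two of its vertices. *)

theory Defs
  imports "HOL-Algebra.Sym_Groups" "HOL-Algebra.Multiplicative_Group" "Graph_Theory.Graph_Theory"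
begin

text \<open>
  As usual for \<open>Graph_Theory\<close>, an undirected simple graph is a loop-free symmetric digraph whose
  arcs are the ordered pairs of adjacent vertices. All constructions below take the group as a
  parameter; \<open>graph_order_super_commuting_graph\<close> confirms that the result is such a graph.
\<close>

definition order_super_commuting_adj :: "('a, 'm) monoid_scheme \<Rightarrow> 'a \<Rightarrow> 'a \<Rightarrow> bool" where
  "order_super_commuting_adj G g h \<longleftrightarrow> g \<noteq> h \<and>
     (group.ord G g = group.ord G h \<or>
      (\<exists>g'\<in>carrier G. \<exists>h'\<in>carrier G.
         group.ord G g' = group.ord G g \<and> group.ord G h' = group.ord G h \<and>
         g' \<noteq> h' \<and> g' \<otimes>\<^bsub>G\<^esub> h' = h' \<otimes>\<^bsub>G\<^esub> g'))"

definition order_super_commuting_graph ::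
    "('a, 'm) monoid_scheme \<Rightarrow> ('a, 'a \<times> 'a) pre_digraph" where
  "order_super_commuting_graph G = with_proj
     \<lparr> pverts = carrier G,
       parcs = {(g, h). g \<in> carrier G \<and> h \<in> carrier G \<and> order_super_commuting_adj G g h} \<rparr>"

definition dominant_vertex :: "('a, 'b) pre_digraph \<Rightarrow> 'a \<Rightarrow> bool" where
  "dominant_vertex H v \<longleftrightarrow> v \<in> verts H \<and> (\<forall>u\<in>verts H. u \<noteq> v \<longrightarrow> v \<rightarrow>\<^bsub>H\<^esub> u)"

definition reduced_order_super_commuting_graph ::
    "('a, 'm) monoid_scheme \<Rightarrow> ('a, 'a \<times> 'a) pre_digraph" where
  "reduced_order_super_commuting_graph G =
     (let H = order_super_commuting_graph G
      in induce_subgraph H (verts H - {v. dominant_vertex H v}))"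

text \<open>
  The distance is the infimum of the costs of walks in which every arc costs 1, i.e. the length of
  a shortest walk (\<open>\<infinity>\<close> if there is none). On a finite nonempty graph the supremum in
  \<open>diameter\<close> is a maximum.
\<close>

definition graph_dist :: "('a, 'b) pre_digraph \<Rightarrow> 'a \<Rightarrow> 'a \<Rightarrow> ereal" where
  "graph_dist H u v = wf_digraph.\<mu> H (\<lambda>_. 1) u v"

definition diameter :: "('a, 'b) pre_digraph \<Rightarrow> ereal" where
  "diameter H = (SUP u\<in>verts H. SUP v\<in>verts H. graph_dist H u v)"

lemma order_super_commuting_adj_sym:
  "order_super_commuting_adj G g h \<Longrightarrow> order_super_commuting_adj G h g"
  unfolding order_super_commuting_adj_def by metis

lemma graph_order_super_commuting_graph:
  assumes "finite (carrier G)"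
  shows "graph (order_super_commuting_graph G)"
proof -
  let ?E = "{(g, h). g \<in> carrier G \<and> h \<in> carrier G \<and> order_super_commuting_adj G g h}"
  have "finite ?E"
    by (rule finite_subset[of _ "carrier G \<times> carrier G"]) (use assms in auto)
  moreover have "g \<noteq> h" if "order_super_commuting_adj G g h" for g h
    using that by (simp add: order_super_commuting_adj_def)
  ultimately show ?thesis
    using assms unfolding order_super_commuting_graph_def
    by unfold_locales
      (auto simp: arc_to_ends_def arcs_ends_def symmetric_def sym_def image_iff
        intro: order_super_commuting_adj_sym)
qed

end

theory Submission
  imports Defs "HOL-Computational_Algebra.Primes" "HOL-Library.Discrete_Functions"
begin

text \<open>
  Adjacency only depends on the orders of the two elements: distinct \<open>g\<close>, \<open>h\<close> are adjacent iff
  some commuting pair has the orders of \<open>g\<close> and \<open>h\<close>. For distinct primes \<open>p\<close>, \<open>q\<close> this means that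
  \<open>A\<^sub>n\<close> has an element of order \<open>p * q\<close>, i.e. \<open>c p + c q \<le> n\<close> where \<open>c 2 = 4\<close> and \<open>c p = p\<close> for odd \<open>p\<close>.

  If one of \<open>n\<close>, \<open>n - 1\<close>, \<open>n - 2\<close> is an odd prime, the elements of this order form a component of
  their own and the reduced graph is disconnected. Otherwise \<open>n \<ge> 10\<close>. Let \<open>p\<close>, \<open>q\<close> be the least primes dividing the orders
  of \<open>u\<close>, \<open>v\<close>. If \<open>p = q\<close> or \<open>c p + c q \<le> n\<close>, then \<open>u\<close>, \<open>v\<close> are joined by a path through elements of order \<open>p\<close>
  and \<open>q\<close>. Otherwise, say, \<open>2 * p > n\<close>, which forces \<open>u\<close> to have order \<open>p \<le> n - 3\<close>, and the path passes
  through orders \<open>3\<close> and \<open>q\<close>.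

  These paths avoid dominant vertices because no prime order \<open>r\<close> is dominant: there is a set \<open>Q\<close> of
  primes other than \<open>r\<close> with \<open>n - c r < (\<Sum>p\<in>Q. c p) \<le> n\<close>, so that \<open>\<Prod>Q\<close> is the order of an element while
  \<open>r * \<Prod>Q\<close> is not. The set \<open>Q\<close> exists because each \<open>x \<ge> 11\<close> is well below the sum of the primes less
  than \<open>x\<close>, which follows from the Chebyshev-type bound \<open>2\<^bsup>x - 3\<^esup> \<le> x\<^bsup>\<pi>(x)\<^esup>\<close>.
\<close>

section \<open>Sums of distinct primes\<close>

text \<open>
  The least degree of an alternating group with an element of the given prime order: an even
  involution needs two transpositions, hence the exception at \<open>2\<close>.
\<close>

definition alt_deg :: "nat \<Rightarrow> nat" where
  "alt_deg p = (if p = 2 then 4 else p)"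

lemma alt_deg_ge: "p \<le> alt_deg p"
  by (simp add: alt_deg_def)

section \<open>Number of primes: a Chebyshev-type bound\<close>

text \<open>The multiplicity of a prime in a least common multiple is the largest of its
  multiplicities in the members, so one member attains it.\<close>

lemma prime_power_dvd_Lcm_nat:
  fixes p :: nat
  assumes "finite A" "prime p" "0 \<notin> A" "k > 0" "p ^ k dvd Lcm A"
  shows "\<exists>a\<in>A. p ^ k dvd a"
  using assms
proof (induction A rule: finite_induct)
  case empty
  then show ?case by auto
next
  case (insert a A)
  have nz: "Lcm A \<noteq> 0" "a \<noteq> 0" "lcm a (Lcm A) \<noteq> 0"
    using insert by (auto simp: Lcm_0_iff lcm_eq_0_iff)
  have u: "\<not> is_unit p" using insert.prems by auto
  have "k \<le> multiplicity p (lcm a (Lcm A))"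
    using insert.prems nz u by (simp flip: power_dvd_iff_le_multiplicity)
  then have "k \<le> multiplicity p a \<or> k \<le> multiplicity p (Lcm A)"
    using nz insert.prems(1) by (simp add: multiplicity_lcm le_max_iff_disj)
  then have "p ^ k dvd a \<or> p ^ k dvd Lcm A"
    using nz u by (simp add: power_dvd_iff_le_multiplicity)
  then show ?case using insert by auto
qed

text \<open>
  The numbers \<open>k * (n choose k)\<close> are the denominators of Leibniz' harmonic triangle; the recurrence
  \<open>1 / L n k + 1 / L n (k + 1) = 1 / L (n - 1) k\<close> gives the induction step.
\<close>

lemma mult_binomial_dvd_Lcm:
  assumes "1 \<le> k" "k \<le> n"
  shows "k * (n choose k) dvd Lcm {1..n}"
  using assms
proof (induction k arbitrary: n rule: nat_induct_at_least)
  case base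
  then show ?case by (auto intro: dvd_Lcm)
next
  case (Suc k)
  obtain m where m: "n = Suc m" "k \<le> m" using Suc.prems by (cases n) auto
  obtain j where j: "k = Suc j" using Suc.hyps by (cases k) auto
  define M where "M = Lcm {1..n}"
  define x where "x = m choose j"
  define y where "y = m choose k"
  have y0: "y > 0" using m by (simp add: y_def)
  have xy: "n choose k = x + y" by (simp add: m j x_def y_def)
  have 1: "k * (x + y) = n * x"
    using Suc_times_binomial_eq[of m j] xy by (simp add: m j x_def mult.commute)
  have 2: "Suc k * (n choose Suc k) = n * y"
    using Suc_times_binomial_eq[of m k] by (simp add: m y_def mult.commute)
  have "k * (x + y) dvd M" using Suc.IH[of n] Suc.prems by (simp add: xy M_def)
  then obtain a where a: "M = k * (x + y) * a" by blast
  have "k * y dvd Lcm {1..m}" using Suc.IH[of m] m by (simp add: y_def)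
  also have "\<dots> dvd M" unfolding M_def by (rule Lcm_subset) (use m in auto)
  finally obtain b where b: "M = k * y * b" by blast
  have k: "int k > 0" using Suc.hyps by simp
  have a': "int M = int n * int x * int a" using a 1 by (metis of_nat_mult)
  have "int k * int y * int M = int k * int y * (int n * int y * (int b - int a))"
  proof -
    have "int n * int y * (int k * int y * int b - int k * int y * int a)
        = int n * int y * (int M - int k * int y * int a)" using b by simp
    also have "int M = int k * (int x + int y) * int a" using a by simp
    also have "int n * int y * (int k * (int x + int y) * int a - int k * int y * int a)
        = int k * int y * (int n * int x * int a)" by (simp add: algebra_simps)
    finally show ?thesis using a' by (simp add: algebra_simps)
  qed
  then have "int M = int n * int y * (int b - int a)" using k y0 by simp
  then have "int (n * y) dvd int M" by simp
  then have "n * y dvd M" by (simp only: of_nat_dvd_iff)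
  then show ?case using 2 by (simp add: M_def)
qed

text \<open>The full power of each prime in the lcm already divides one member, hence is at most n,
  and there is at most one such factor per prime up to n.\<close>

lemma Lcm_le_power_card_primes:
  assumes "n > (0::nat)"
  shows "Lcm {1..n} \<le> n ^ card {p. prime p \<and> p \<le> n}"
proof -
  let ?M = "Lcm {1..n}"
  have M0: "?M \<noteq> 0" using Lcm_0_iff[of "{1..n}"] by auto
  have sub: "prime_factors ?M \<subseteq> {p. prime p \<and> p \<le> n}"
  proof
    fix p assume "p \<in> prime_factors ?M"
    then have p: "prime p" "p dvd ?M" by auto
    then obtain a where "a \<in> {1..n}" "p dvd a"
      using prime_power_dvd_Lcm_nat[of "{1..n}" p 1] by auto
    then show "p \<in> {p. prime p \<and> p \<le> n}" using p by (auto dest!: dvd_imp_le)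
  qed
  have fin: "finite {p. prime p \<and> p \<le> n}" by simp
  have "?M = (\<Prod>p\<in>prime_factors ?M. p ^ multiplicity p ?M)"
    using M0 by (metis prime_factorization_nat neq0_conv)
  also have "\<dots> \<le> (\<Prod>p\<in>prime_factors ?M. n)"
  proof (rule prod_mono, safe)
    fix p assume p: "p \<in> prime_factors ?M"
    then have "multiplicity p ?M > 0" by (simp add: prime_factors_multiplicity)
    then obtain a where "a \<in> {1..n}" "p ^ multiplicity p ?M dvd a"
      using prime_power_dvd_Lcm_nat[of "{1..n}" p "multiplicity p ?M"] in_prime_factors_imp_prime[OF p]
      by (auto simp: multiplicity_dvd)
    then show "p ^ multiplicity p ?M \<le> n" by (auto dest!: dvd_imp_le)
  qed
  also have "\<dots> = n ^ card (prime_factors ?M)" by simp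
  also have "\<dots> \<le> n ^ card {p. prime p \<and> p \<le> n}"
    using assms card_mono[OF fin sub] by (intro power_increasing) auto
  finally show ?thesis .
qed

text \<open>Chebyshev's argument: \<open>m * (2 * m choose m)\<close> is at least
  \<open>4 ^ m / 2\<close> and divides the lcm of 1 to 2m. Of the 3 lost in the exponent, 2 come
  from 2m \<ge> x - 2 and 1 from the factor 1/2.\<close>

lemma two_power_le_power_card_primes:
  assumes "x \<ge> 4"
  shows "2 ^ (x - 3) \<le> x ^ card {p. prime p \<and> p < (x::nat)}"
proof -
  \<comment> \<open>The largest m with 2m < x, because only primes strictly below x are
    counted.\<close>
  define m where "m = (x - 1) div 2"
  have m: "m > 0" "2 * m < x" "x \<le> 2 * m + 2" using assms by (auto simp: m_def)
  have "4 ^ m / (2 * real m) \<le> real (2 * m choose m)"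
    using central_binomial_lower_bound[of m] m by simp
  then have "real (4 ^ m) \<le> real (2 * (m * (2 * m choose m)))"
    using m by (simp add: field_simps)
  then have "4 ^ m \<le> 2 * (m * (2 * m choose m))" by (simp only: of_nat_le_iff)
  also have "m * (2 * m choose m) \<le> Lcm {1..2 * m}"
    using mult_binomial_dvd_Lcm[of m "2 * m"] m
    by (intro dvd_imp_le) (auto simp: Lcm_0_iff intro!: Nat.gr0I)
  also have "Lcm {1..2 * m} \<le> (2 * m) ^ card {p. prime p \<and> p \<le> 2 * m}"
    by (rule Lcm_le_power_card_primes) (use m in auto)
  also have "\<dots> \<le> x ^ card {p. prime p \<and> p \<le> 2 * m}"
    using m by (intro power_mono) auto
  also have "\<dots> \<le> x ^ card {p. prime p \<and> p < x}"
    using m by (intro power_increasing card_mono) auto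
  finally have A: "4 ^ m \<le> 2 * x ^ card {p. prime p \<and> p < x}" by simp
  have "2 * 2 ^ (x - 3) = (2::nat) ^ (x - 2)"
    using assms by (simp flip: power_Suc)
  also have "\<dots> \<le> 2 ^ (2 * m)" using m by (intro power_increasing) auto
  also have "\<dots> = 4 ^ m" by (simp add: power_mult)
  finally show ?thesis using A by simp
qed

section \<open>Sum of the primes below x\<close>

text \<open>If c primes lie below a prime x > 2, they are 2 and odd numbers from 3 to x - 2, so 2c +
  1 \<le> x, and 2c + 1 is the increment of the square. The surplus 3 comes from
  \<open>alt_deg 2 = 4\<close> at x = 3.\<close>

lemma card_primes_sqr_le:
  assumes "x \<ge> (3::nat)"
  shows "(card {p. prime p \<and> p < x})\<^sup>2 + 3 \<le> (\<Sum>p | prime p \<and> p < x. alt_deg p)"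
  using assms
proof (induction x rule: nat_induct_at_least)
  case base
  have "{p. prime p \<and> p < (3::nat)} = {2}"
    by (auto dest: prime_gt_1_nat simp: less_Suc_eq numeral_3_eq_3 two_is_prime_nat[unfolded numeral_2_eq_2] numeral_2_eq_2)
  then show ?case by (simp add: alt_deg_def)
next
  case (Suc x)
  show ?case
  proof (cases "prime x")
    case False
    then have "{p. prime p \<and> p < Suc x} = {p. prime p \<and> p < x}" by (auto simp: less_Suc_eq)
    then show ?thesis using Suc.IH by simp
  next
    case True
    let ?P = "{p. prime p \<and> p < x}"
    have eq: "{p. prime p \<and> p < Suc x} = insert x ?P" using True by (auto simp: less_Suc_eq)
    have "?P \<subseteq> insert 2 ((\<lambda>i. 2 * i + 1) ` {1..<x div 2})"
    proof
      fix p assume p: "p \<in> ?P"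
      show "p \<in> insert 2 ((\<lambda>i. 2 * i + 1) ` {1..<x div 2})"
      proof (cases "p = 2")
        case False
        then have o: "odd p" "p > 2" "odd x"
          using p True Suc.hyps prime_odd_nat[of p] prime_gt_1_nat[of p] prime_odd_nat[of x] by auto
        then obtain i where i: "p = 2 * i + 1" by (elim oddE)
        then show ?thesis using o p by (auto elim!: oddE)
      qed auto
    qed
    then have "card ?P \<le> card (insert 2 ((\<lambda>i. 2 * i + 1) ` {1..<x div 2}))"
      by (rule card_mono[rotated]) auto
    also have "\<dots> \<le> Suc (card {1..<x div 2})"
      by (rule order_trans[OF card_insert_le_m1]) (auto simp: card_image inj_on_def intro: card_image_le)
    finally have "card ?P \<le> x div 2" using Suc.hyps by auto
    moreover have "odd x" using True Suc.hyps prime_odd_nat[of x] by auto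
    ultimately have "2 * card ?P + 1 \<le> x" using odd_two_times_div_two_succ[of x] by linarith
    then show ?thesis using Suc.IH Suc.hyps eq
      by (simp add: alt_deg_def power2_eq_square)
  qed
qed

lemma sum_list_alt_deg_le:
  assumes "finite B" "set xs \<subseteq> B" "distinct xs"
  shows "sum_list (map alt_deg xs) \<le> sum alt_deg B"
proof -
  have "sum_list (map alt_deg xs) = sum alt_deg (set xs)"
    using assms(3) by (simp add: sum_list_distinct_conv_sum_set)
  also have "\<dots> \<le> sum alt_deg B" using assms by (intro sum_mono2) auto
  finally show ?thesis .
qed

lemma square_le_two_power: "u \<ge> 9 \<Longrightarrow> (u + 1)\<^sup>2 \<le> (2::nat) ^ (u - 2)"
proof (induction u rule: nat_induct_at_least)
  case (Suc u)
  have "(Suc u + 1)\<^sup>2 \<le> 2 * (u + 1)\<^sup>2"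
  proof -
    have "9 * u \<le> u * u" using Suc.hyps by simp
    then have "2 * u + 2 \<le> u * u" using Suc.hyps by linarith
    then show ?thesis by (simp add: power2_eq_square)
  qed
  also have "\<dots> \<le> 2 * 2 ^ (u - 2)" using Suc.IH by simp
  also have "\<dots> = 2 ^ (Suc u - 2)" using Suc.hyps by (simp flip: power_Suc add: Suc_diff_le)
  finally show ?case .
qed simp

text \<open>A small sum forces few primes, about sqrt x by the square bound; then
  \<open>x ^ s\<close> falls below \<open>2 ^ (x - 3)\<close>, against the Chebyshev-type bound. The
  threshold 81 is the square of 9, from which on \<open>(u + 1)\<^sup>2 \<le> 2 ^ (u - 2)\<close>
  holds.\<close>

lemma sum_alt_deg_primes_ge_large:
  assumes "x \<ge> 81"
  shows "x + 8 \<le> (\<Sum>p | prime p \<and> p < (x::nat). alt_deg p)"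
proof (rule ccontr)
  define s :: nat where "s = card {p. prime p \<and> p < x}"
  define u :: nat where "u = floor_sqrt x"
  have u1: "u\<^sup>2 \<le> x" "x < (Suc u)\<^sup>2"
    by (auto simp: u_def floor_sqrt_power2_le Suc_floor_sqrt_power2_gt)
  have u9: "u \<ge> 9" unfolding u_def by (rule le_floor_sqrtI) (use assms in simp)
  assume "\<not> ?thesis"
  then have s2: "s\<^sup>2 < x + 5" using card_primes_sqr_le[of x] assms by (simp add: s_def)
  have su: "s < u + 2"
  proof (rule power_less_imp_less_base)
    show "s\<^sup>2 < (u + 2)\<^sup>2" using s2 u1(2) u9 by (simp add: power2_eq_square)
  qed simp
  have "2 ^ (x - 3) \<le> x ^ s"
    using two_power_le_power_card_primes[of x] assms by (simp add: s_def)
  also have "\<dots> \<le> x ^ (u + 1)" using su assms by (intro power_increasing) simp_all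
  also have "\<dots> < ((u + 1)\<^sup>2) ^ (u + 1)" using u1(2) by (intro power_strict_mono) simp_all
  also have "\<dots> \<le> (2 ^ (u - 2)) ^ (u + 1)" by (rule power_mono[OF square_le_two_power[OF u9]]) simp
  also have "\<dots> = 2 ^ ((u - 2) * (u + 1))" by (rule power_mult[symmetric])
  also have "\<dots> \<le> 2 ^ (x - 3)"
  proof (rule power_increasing)
    define w where "w = u - 2"
    then have w: "u = w + 2" using u9 by simp
    show "(u - 2) * (u + 1) \<le> x - 3" using u1(1) by (simp add: w power2_eq_square)
  qed simp
  finally show False by simp
qed

text \<open>The surplus 8 is twice the offset 4 with which the greedy argument runs when r =
  3.\<close>

lemma sum_alt_deg_primes_ge:
  assumes "x \<ge> 11"
  shows "x + 8 \<le> (\<Sum>p | prime p \<and> p < (x::nat). alt_deg p)"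
proof -
  have primes: "prime (2::nat)" "prime (3::nat)" "prime (5::nat)" "prime (7::nat)" "prime (11::nat)"
     "prime (13::nat)" "prime (17::nat)" "prime (19::nat)" "prime (23::nat)"
    by simp_all
  have *: "x + 8 \<le> sum alt_deg {p. prime p \<and> p < x}"
    if "set ps \<subseteq> {p. prime p \<and> p < x}" "distinct ps" "x + 8 \<le> sum_list (map alt_deg ps)" for ps
    using sum_list_alt_deg_le[of "{p. prime p \<and> p < x}" ps] that by auto
  \<comment> \<open>Each list of primes is used up to the x at which its total weight is exactly x +
    8.\<close>
  consider "x \<le> 11" | "12 \<le> x" "x \<le> 22" | "23 \<le> x" "x \<le> 35" | "36 \<le> x" "x \<le> 71"
    | "72 \<le> x" "x \<le> 94" | "x \<ge> 81" by linarith
  then show ?thesis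
  proof cases
    case 1
    show ?thesis by (rule *[of "[2, 3, 5, 7]"]) (use primes assms 1 in \<open>auto simp: alt_deg_def\<close>)
  next
    case 2
    show ?thesis by (rule *[of "[2, 3, 5, 7, 11]"]) (use primes 2 in \<open>auto simp: alt_deg_def\<close>)
  next
    case 3
    show ?thesis by (rule *[of "[2, 3, 5, 7, 11, 13]"]) (use primes 3 in \<open>auto simp: alt_deg_def\<close>)
  next
    case 4
    show ?thesis by (rule *[of "[2, 3, 5, 7, 11, 13, 17, 19]"]) (use primes 4 in \<open>auto simp: alt_deg_def\<close>)
  next
    case 5
    show ?thesis by (rule *[of "[2, 3, 5, 7, 11, 13, 17, 19, 23]"]) (use primes 5 in \<open>auto simp: alt_deg_def\<close>)
  next
    case 6
    then show ?thesis by (rule sum_alt_deg_primes_ge_large)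
  qed
qed

text \<open>
  Richert's greedy argument. It applies because a prime never exceeds the sum of its predecessors.
  The offset \<open>A\<close> is needed for \<open>r = 3\<close> only, where the value \<open>N = 3\<close> is missed.
\<close>

lemma prime_sum_window_upto:
  assumes base: "\<And>N. A \<le> N \<Longrightarrow> N + A < sum alt_deg {p. prime p \<and> p < k\<^sub>0 \<and> p \<noteq> r} + w \<Longrightarrow>
      \<exists>Q\<subseteq>{p. prime p \<and> p < k\<^sub>0 \<and> p \<noteq> r}. sum alt_deg Q \<le> N \<and> N < sum alt_deg Q + w"
    and step: "\<And>k. k\<^sub>0 \<le> k \<Longrightarrow> prime k \<Longrightarrow> k \<noteq> r \<Longrightarrow>
      alt_deg k + 2 * A \<le> sum alt_deg {p. prime p \<and> p < k \<and> p \<noteq> r} + w"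
    and "k\<^sub>0 \<le> k" "A \<le> N" "N + A < sum alt_deg {p. prime p \<and> p < k \<and> p \<noteq> r} + w"
  shows "\<exists>Q\<subseteq>{p. prime p \<and> p < k \<and> p \<noteq> r}. sum alt_deg Q \<le> N \<and> N < sum alt_deg Q + w"
  using assms(3-)
proof (induction k arbitrary: N rule: dec_induct)
  case base
  show ?case by (rule assms(1)[OF base.prems])
next
  case (step k)
  let ?P = "\<lambda>k. {p. prime p \<and> p < k \<and> p \<noteq> r}"
  show ?case
  proof (cases "prime k \<and> k \<noteq> r")
    case False
    then have "?P (Suc k) = ?P k" by (auto simp: less_Suc_eq)
    then show ?thesis using step.IH[of N] step.prems by simp
  next
    case True
    have eq: "?P (Suc k) = insert k (?P k)" using True by (auto simp: less_Suc_eq)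
    show ?thesis
    proof (cases "N + A < sum alt_deg (?P k) + w")
      case True
      then obtain Q where "Q \<subseteq> ?P k" "sum alt_deg Q \<le> N" "N < sum alt_deg Q + w"
        using step.IH[of N] step.prems(1) by blast
      moreover from this(1) have "Q \<subseteq> ?P (Suc k)" unfolding eq by blast
      ultimately show ?thesis by blast
    next
      case False
      have "alt_deg k + 2 * A \<le> sum alt_deg (?P k) + w"
        using assms(2)[of k] step.hyps True by simp
      then have le: "alt_deg k + A \<le> N" using False by linarith
      have "N - alt_deg k + A < sum alt_deg (?P k) + w"
      proof -
        have "sum alt_deg (?P (Suc k)) = alt_deg k + sum alt_deg (?P k)" unfolding eq by simp
        then show ?thesis using step.prems(2) le by linarith
      qed
      moreover have "A \<le> N - alt_deg k" using le by linarith
      ultimately obtain Q where Q: "Q \<subseteq> ?P k" "sum alt_deg Q \<le> N - alt_deg k"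
          "N - alt_deg k < sum alt_deg Q + w"
        using step.IH[of "N - alt_deg k"] by blast
      have "finite Q" by (rule finite_subset[OF Q(1)]) simp
      moreover have "k \<notin> Q" using Q(1) by auto
      ultimately have "sum alt_deg (insert k Q) = alt_deg k + sum alt_deg Q" by simp
      then have "sum alt_deg (insert k Q) \<le> N" "N < sum alt_deg (insert k Q) + w"
        using Q(2,3) le by linarith+
      moreover have "insert k Q \<subseteq> ?P (Suc k)" unfolding eq using Q(1) by blast
      ultimately show ?thesis by blast
    qed
  qed
qed

section \<open>Conditions of the greedy argument\<close>

lemma sum_alt_deg_primes_remove:
  assumes "prime r" "r < k"
  shows "sum alt_deg {p. prime p \<and> p < k \<and> p \<noteq> r} + alt_deg r = sum alt_deg {p. prime p \<and> p < k}"
proof -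
  have "{p. prime p \<and> p < k} = insert r {p. prime p \<and> p < k \<and> p \<noteq> r}" using assms by auto
  then show ?thesis by simp
qed

lemma alt_deg_le_sum_primes:
  assumes "prime k" "k > 3"
  shows "alt_deg k \<le> sum alt_deg {p. prime p \<and> p < k}"
proof (cases "k \<ge> 11")
  case True
  then show ?thesis using sum_alt_deg_primes_ge[of k] by (simp add: alt_deg_def)
next
  case False
  have p: "prime (2::nat)" "prime (3::nat)" "prime (5::nat)" "\<not> prime (4::nat)" by simp_all
  show ?thesis
  proof (cases "k \<le> 7")
    case True
    then show ?thesis using sum_list_alt_deg_le[of "{p. prime p \<and> p < k}" "[2, 3]"] assms p
      by (auto simp: alt_deg_def)
  next
    case False
    then show ?thesis using sum_list_alt_deg_le[of "{p. prime p \<and> p < k}" "[2, 3, 5]"] assms p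
      \<open>\<not> k \<ge> 11\<close> by (auto simp: alt_deg_def)
  qed
qed

text \<open>An element of order \<open>\<Prod>Q\<close> leaves too few of the n points for a further
  factor r: fewer than \<open>alt_deg r\<close> remain.\<close>

lemma prime_sum_window:
  assumes "prime r" "n \<ge> 4"
  shows "\<exists>Q. finite Q \<and> (\<forall>p\<in>Q. prime p) \<and> r \<notin> Q \<and> sum alt_deg Q \<le> n \<and> n < sum alt_deg Q + alt_deg r"
proof -
  let ?P = "\<lambda>k. {p. prime p \<and> p < k \<and> p \<noteq> r}"
  \<comment> \<open>Large enough that r < k and that the primes below k outweigh n plus the offset,
    which is 0 or 4.\<close>
  define k where "k = n + r + 20"
  then have k: "k \<ge> n + 20" "k > r" by simp_all
  have sum_k: "n + 8 < sum alt_deg (?P k) + alt_deg r"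
    using sum_alt_deg_primes_ge[of k] sum_alt_deg_primes_remove[OF assms(1) k(2)] k(1) by simp
  have "\<exists>Q\<subseteq>?P k. sum alt_deg Q \<le> n \<and> n < sum alt_deg Q + alt_deg r"
  proof (cases "r = 3")
    case False
    show ?thesis
    \<comment> \<open>No offset, starting from no primes at all: the empty sum 0 covers every N
      below \<open>alt_deg r\<close>.\<close>
    proof (rule prime_sum_window_upto[where A = 0 and k\<^sub>0 = 0])
      fix k assume k: "prime k" "k \<noteq> r"
      show "alt_deg k + 2 * 0 \<le> sum alt_deg (?P k) + alt_deg r"
      proof (cases "k > 3 \<and> r < k")
        case True
        then show ?thesis
          using alt_deg_le_sum_primes[OF k(1)] sum_alt_deg_primes_remove[OF assms(1), of k] by simp
      next
        case F: False
        have "k > 1" "r > 1" "r \<noteq> 4" using k assms by (auto dest: prime_gt_1_nat)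
        \<comment> \<open>The window alone suffices, as \<open>alt_deg k \<le> alt_deg r\<close>.
          This would fail only for k = 2 and r = 3, the case split off.\<close>
        then show ?thesis using False F k by (auto simp: alt_deg_def)
      qed
    qed (use sum_k in auto)
  next
    case True
    have P8: "?P 8 = {2, 5, 7}"
    proof -
      have np: "\<not> prime (4::nat)" "\<not> prime (6::nat)" by simp_all
      have A: "p = 2 \<or> p = 5 \<or> p = 7" if p: "prime p" "p < 8" "p \<noteq> 3" for p :: nat
      proof -
        have "p > 1" using p by (auto dest: prime_gt_1_nat)
        then have "p = 2 \<or> p = 4 \<or> p = 5 \<or> p = 6 \<or> p = 7" using p by linarith
        then show ?thesis using np p by auto
      qed
      have B: "prime (2::nat)" "prime (5::nat)" "prime (7::nat)" by simp_all
      show ?thesis unfolding True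
      proof (intro subset_antisym subsetI)
        fix p :: nat assume "p \<in> {p. prime p \<and> p < 8 \<and> p \<noteq> 3}"
        then show "p \<in> {2, 5, 7}" using A[of p] by simp
      next
        fix p assume "p \<in> {2, 5, 7 :: nat}"
        then show "p \<in> {p. prime p \<and> p < 8 \<and> p \<noteq> 3}" using B by auto
      qed
    qed
    show ?thesis
    \<comment> \<open>The next prime after 7 is 11, from which on the sum bound with surplus 8 = 2 *
      4 applies; the primes below 8 are treated by hand.\<close>
    proof (rule prime_sum_window_upto[where A = 4 and k\<^sub>0 = 8])
      fix N :: nat assume N: "4 \<le> N" "N + 4 < sum alt_deg (?P 8) + alt_deg r"
      have "N < 15" using N(2) unfolding P8 by (simp add: True alt_deg_def)
      \<comment> \<open>The sums 4, 5, 7, 9, 11, 12 of the weights 4, 5, 7 start windows of length 3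
        that together cover 4 to 14.\<close>
      then consider "N \<le> 4" | "5 \<le> N" "N \<le> 6" | "7 \<le> N" "N \<le> 8" | "9 \<le> N" "N \<le> 10" | "11 \<le> N" "N \<le> 11"
        | "12 \<le> N" "N \<le> 14" by linarith
      then show "\<exists>Q\<subseteq>?P 8. sum alt_deg Q \<le> N \<and> N < sum alt_deg Q + alt_deg r"
      proof cases
        case 1 then show ?thesis unfolding P8 using N(1) True by (intro exI[of _ "{2}"]) (auto simp: alt_deg_def)
      next case 2 then show ?thesis unfolding P8 using N(1) True by (intro exI[of _ "{5}"]) (auto simp: alt_deg_def)
      next case 3 then show ?thesis unfolding P8 using N(1) True by (intro exI[of _ "{7}"]) (auto simp: alt_deg_def)
      next case 4 then show ?thesis unfolding P8 using N(1) True by (intro exI[of _ "{2, 5}"]) (auto simp: alt_deg_def)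
      next case 5 then show ?thesis unfolding P8 using N(1) True by (intro exI[of _ "{2, 7}"]) (auto simp: alt_deg_def)
      next case 6 then show ?thesis unfolding P8 using N(1) True by (intro exI[of _ "{5, 7}"]) (auto simp: alt_deg_def)
      qed
    next
      fix k :: nat assume k: "8 \<le> k" "prime k" "k \<noteq> r"
      have "\<not> prime (8::nat)" "\<not> prime (9::nat)" "\<not> prime (10::nat)" by simp_all
      then have "k \<noteq> 8" "k \<noteq> 9" "k \<noteq> 10" using k(2) by metis+
      then have "k \<ge> 11" using k by linarith
      then show "alt_deg k + 2 * 4 \<le> sum alt_deg (?P k) + alt_deg r"
        using sum_alt_deg_primes_ge[of k] sum_alt_deg_primes_remove[OF assms(1), of k] True
        by (simp add: alt_deg_def)
    qed (use sum_k k assms in auto)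
  qed
  then obtain Q where "Q \<subseteq> ?P k" "sum alt_deg Q \<le> n" "n < sum alt_deg Q + alt_deg r" by blast
  moreover from this(1) have "finite Q" by (rule finite_subset) auto
  ultimately show ?thesis by blast
qed

section \<open>Orders of even permutations\<close>

lemma funpow_comp_commute:
  fixes f g :: "'a \<Rightarrow> 'a"
  assumes "f \<circ> g = g \<circ> f"
  shows "(f \<circ> g) ^^ m = (f ^^ m) \<circ> (g ^^ m)"
proof (induction m)
  case (Suc m)
  have "(f \<circ> g) ^^ Suc m = f \<circ> (g \<circ> (f ^^ m)) \<circ> (g ^^ m)"
    unfolding funpow.simps(2) Suc comp_assoc ..
  also have "g \<circ> (f ^^ m) = (f ^^ m) \<circ> g"
  proof (induction m)
    case (Suc m)
    then show ?case using assms by (metis comp_assoc funpow.simps(2))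
  qed auto
  finally show ?case by (simp add: comp_assoc funpow_swap1)
qed auto

lemma disjoint_permutes_commute:
  assumes "f permutes A" "g permutes B" "A \<inter> B = {}"
  shows "f \<circ> g = g \<circ> f"
proof
  fix x
  show "(f \<circ> g) x = (g \<circ> f) x"
    using assms permutes_not_in[OF assms(1)] permutes_not_in[OF assms(2)]
      permutes_in_image[OF assms(1)] permutes_in_image[OF assms(2)] by (metis comp_apply disjoint_iff)
qed

lemma disjoint_permutes_comp_eq_id:
  assumes "f permutes A" "g permutes B" "A \<inter> B = {}"
  shows "f \<circ> g = id \<longleftrightarrow> f = id \<and> g = id"
proof
  assume eq: "f \<circ> g = id"
  have "g x = x" for x
  proof (cases "x \<in> B")
    case True
    then have "g x \<in> B" using permutes_in_image[OF assms(2)] by blast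
    then have "f (g x) = g x" using permutes_not_in[OF assms(1)] assms(3) by blast
    then show ?thesis using fun_cong[OF eq, of x] by simp
  qed (rule permutes_not_in[OF assms(2)])
  then have "g = id" by auto
  then show "f = id \<and> g = id" using eq by simp
qed simp

lemma evenperm_cycle_of_list:
  assumes "distinct cs" "cs \<noteq> []"
  shows "evenperm (cycle_of_list cs) \<longleftrightarrow> odd (length cs)"
  using assms
proof (induction cs rule: cycle_of_list.induct)
  case (1 i j cs)
  have "evenperm (transpose i j \<circ> cycle_of_list (j # cs)) \<longleftrightarrow>
      (evenperm (transpose i j) \<longleftrightarrow> evenperm (cycle_of_list (j # cs)))"
    by (rule evenperm_comp) (auto simp: permutation_swap_id permutation_of_cycle)
  then show ?case using 1 by (simp add: evenperm_swap del: comp_apply o_apply)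
qed (simp_all add: evenperm_id)

text \<open>\<open>ls\<close> is the cycle type, fixed points being cycles of length 1. The last
  clause says that the order divides the lcm of the lengths, the direction used for lower bounds on
  the degree.\<close>

lemma cycle_lengths:
  assumes "p permutes S" "finite S"
  shows "\<exists>ls. 0 \<notin> set ls \<and> sum_list ls = card S \<and> (evenperm p \<longleftrightarrow> even (length (filter even ls))) \<and>
    (\<forall>m. (\<forall>l\<in>set ls. l dvd m) \<longrightarrow> p ^^ m = id)"
proof -
  have "cycle_decomp S p" using assms by (rule cycle_decomposition)
  then have "p permutes S \<and> finite S \<and> (\<exists>ls. 0 \<notin> set ls \<and> sum_list ls = card S \<and>
      (evenperm p \<longleftrightarrow> even (length (filter even ls))) \<and>
      (\<forall>m. (\<forall>l\<in>set ls. l dvd m) \<longrightarrow> p ^^ m = id))"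
  proof induction
    case empty
    then show ?case using permutes_id evenperm_id id_funpow by (fastforce intro!: exI[of _ "[]"])
  next
    case (comp I p cs)
    then obtain ls where ls: "0 \<notin> set ls" "sum_list ls = card I"
        "evenperm p \<longleftrightarrow> even (length (filter even ls))" "\<And>m. (\<forall>l\<in>set ls. l dvd m) \<Longrightarrow> p ^^ m = id"
      by blast
    have p: "p permutes I" "finite I" using comp.IH by auto
    let ?c = "cycle_of_list cs"
    have c: "?c permutes set cs" by (rule cycle_permutes)
    have "?c \<circ> p permutes set cs \<union> I"
      using c p permutes_subset by (blast intro: permutes_compose)
    moreover have "\<exists>ls. 0 \<notin> set ls \<and> sum_list ls = card (set cs \<union> I) \<and>
      (evenperm (?c \<circ> p) \<longleftrightarrow> even (length (filter even ls))) \<and>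
      (\<forall>m. (\<forall>l\<in>set ls. l dvd m) \<longrightarrow> (?c \<circ> p) ^^ m = id)"
    \<comment> \<open>The decomposition admits an empty cycle, which acts as the identity; its
      length 0 must stay out of the list.\<close>
    proof (cases "cs = []")
      case True
      then show ?thesis using ls by (intro exI[of _ ls]) auto
    next
      case False
      have "evenperm (?c \<circ> p) \<longleftrightarrow> (evenperm ?c \<longleftrightarrow> evenperm p)"
        by (rule evenperm_comp) (use p permutation_of_cycle in \<open>auto simp: permutation_permutes\<close>)
      moreover have "(?c \<circ> p) ^^ m = id" if m: "\<forall>l\<in>set (length cs # ls). l dvd m" for m
      proof -
        obtain k where k: "m = length cs * k" using m by auto
        have "?c ^^ m = id" unfolding k funpow_mult[symmetric] cycle_is_id_root[OF comp.hyps(2)] by simp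
        moreover have "p ^^ m = id" using m ls(4) by simp
        ultimately show ?thesis
          using funpow_comp_commute[OF disjoint_permutes_commute[OF c p(1) comp.hyps(3)]] by simp
      qed
      moreover have "card (set cs \<union> I) = length cs + card I"
        using comp.hyps p by (simp add: card_Un_disjoint distinct_card)
      ultimately show ?thesis
        using ls(1-3) evenperm_cycle_of_list[OF comp.hyps(2) False] False
        by (intro exI[of _ "length cs # ls"]) auto
    qed
    ultimately show ?case using p(2) by blast
  qed
  then show ?thesis by blast
qed

section \<open>Degree forced by the prime divisors of an order\<close>

lemma sum_le_prod_primes:
  assumes "finite A" "\<And>a. a \<in> A \<Longrightarrow> 2 \<le> (a::nat)" "A \<noteq> {}"
  shows "\<Sum>A \<le> \<Prod>A"
  using assms(1,3,2)
proof (induction A rule: finite_ne_induct)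
  case (insert x A)
  have IH: "\<Sum>A \<le> \<Prod>A" using insert by auto
  have x: "2 \<le> x" using insert by auto
  obtain y where "y \<in> A" using insert by auto
  then have "2 \<le> y" "y \<le> \<Sum>A" using insert by (auto intro: member_le_sum)
  then have P: "2 \<le> \<Prod>A" using IH by linarith
  have "x + \<Prod>A \<le> x * \<Prod>A"
  proof -
    obtain a b where "x = a + 2" "\<Prod>A = b + 2" using x P by (metis add.commute le_Suc_ex)
    then show ?thesis by (simp add: algebra_simps)
  qed
  then show ?case using insert IH by simp
qed simp

lemma prod_primes_dvd_iff:
  assumes "finite P" "\<And>p. p \<in> P \<Longrightarrow> prime (p::nat)"
  shows "\<Prod>P dvd m \<longleftrightarrow> (\<forall>p\<in>P. p dvd m)"
  using assms
proof (induction P rule: finite_induct)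
  case (insert x P)
  have "coprime x (\<Prod>P)"
    by (rule prod_coprime_right) (use insert in \<open>auto intro!: primes_coprime\<close>)
  then have "x * \<Prod>P dvd m \<longleftrightarrow> x dvd m \<and> \<Prod>P dvd m"
    by (meson divides_mult dvd_mult_left dvd_mult_right)
  then show ?case using insert by simp
qed simp

text \<open>A product of numbers that are at least 2 is no less than their sum, so packing several
  primes into one cycle saves no points.\<close>

lemma sum_primes_dvd_le:
  assumes "finite P" "\<And>p. p \<in> P \<Longrightarrow> prime (p::nat)" "\<And>p. p \<in> P \<Longrightarrow> p dvd l" "l > 0"
  shows "\<Sum>P \<le> l"
proof (cases "P = {}")
  case False
  have "\<Sum>P \<le> \<Prod>P" by (rule sum_le_prod_primes) (use assms False in \<open>auto dest: prime_ge_2_nat\<close>)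
  also have "\<dots> \<le> l" using assms by (intro dvd_imp_le) (auto simp: prod_primes_dvd_iff)
  finally show ?thesis .
qed simp

text \<open>Double counting: each cycle is charged with the primes of P that divide its length, in
  total at most its length, and each p is charged at least \<open>alt_deg p\<close> overall.\<close>

lemma sum_alt_deg_le_sum_list:
  assumes "finite P" "\<And>p. p \<in> P \<Longrightarrow> prime p" "0 \<notin> set ls" "even (length (filter even ls))"
    "\<And>p. p \<in> P \<Longrightarrow> \<exists>l\<in>set ls. p dvd l"
  shows "sum alt_deg P \<le> sum_list ls"
proof -
  have le: "(\<Sum>p\<in>P. p * length (filter ((dvd) p) ls)) \<le> sum_list ls"
    using assms(3)
  proof (induction ls)
    case (Cons l ls)
    have "(\<Sum>p\<in>P. p * length (filter ((dvd) p) (l # ls)))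
        = (\<Sum>p\<in>P. p * length (filter ((dvd) p) ls) + (if p dvd l then p else 0))"
      by (rule sum.cong) auto
    also have "\<dots> = (\<Sum>p\<in>P. p * length (filter ((dvd) p) ls)) + \<Sum>{p\<in>P. p dvd l}"
      using assms(1) by (simp add: sum.distrib sum.inter_filter)
    also have "\<Sum>{p\<in>P. p dvd l} \<le> l" by (rule sum_primes_dvd_le) (use assms Cons.prems in auto)
    finally show ?case using Cons by simp
  qed simp
  have "alt_deg p \<le> p * length (filter ((dvd) p) ls)" if p: "p \<in> P" for p
  proof -
    have "filter ((dvd) p) ls \<noteq> []" using assms(5)[OF p] by (auto simp: filter_empty_conv)
    then have pos: "length (filter ((dvd) p) ls) > 0" by simp
    show ?thesis
    proof (cases "p = 2")
      case True
      \<comment> \<open>A nonzero even number of even cycles is at least 2, which accounts for the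
        weight 4 of the prime 2.\<close>
      then have "length (filter ((dvd) p) ls) \<ge> 2" using pos assms(4) by (cases "filter even ls" rule: remdups_adj.cases) auto
      then show ?thesis using True by (simp add: alt_deg_def)
    next
      case False
      then show ?thesis using pos by (cases "length (filter ((dvd) p) ls)") (simp_all add: alt_deg_def)
    qed
  qed
  then have "sum alt_deg P \<le> (\<Sum>p\<in>P. p * length (filter ((dvd) p) ls))" by (rule sum_mono)
  then show ?thesis using le by linarith
qed

lemma alt_group_pow: "g [^]\<^bsub>alt_group n\<^esub> (m::nat) = g ^^ m"
proof (induction m)
  case (Suc m)
  then show ?case using nat_pow_def[of "alt_group n" g "Suc m"] by (simp add: alt_group_mult funpow_Suc_right nat_pow_def del: funpow.simps)
qed (simp add: alt_group_one nat_pow_def)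

lemma alt_group_ord_dvd_iff:
  assumes "g \<in> carrier (alt_group n)"
  shows "group.ord (alt_group n) g dvd m \<longleftrightarrow> g ^^ m = id"
  using group.pow_eq_id[OF alt_group_is_group assms, of m] by (simp add: alt_group_pow alt_group_one)

lemma alt_group_finite: "finite (carrier (alt_group n))"
  by (rule finite_subset[OF _ finite_permutations[of "{1..n}"]]) (auto simp: alt_group_carrier)

lemma alt_group_ord_cycle_lengths:
  assumes "g \<in> carrier (alt_group n)"
  shows "\<exists>ls. 0 \<notin> set ls \<and> sum_list ls = n \<and> even (length (filter even ls)) \<and>
    group.ord (alt_group n) g dvd Lcm (set ls)"
proof -
  have g: "g permutes {1..n}" "evenperm g" using assms by (auto simp: alt_group_carrier)
  then obtain ls where "0 \<notin> set ls" "sum_list ls = n" "even (length (filter even ls))"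
      "\<And>m. (\<forall>l\<in>set ls. l dvd m) \<Longrightarrow> g ^^ m = id"
    using cycle_lengths[OF g(1)] by auto
  moreover from this(4)[of "Lcm (set ls)"] have "group.ord (alt_group n) g dvd Lcm (set ls)"
    by (simp add: alt_group_ord_dvd_iff[OF assms])
  ultimately show ?thesis by blast
qed

lemma alt_group_prime_power_dvd_ord:
  assumes "g \<in> carrier (alt_group n)" "prime p" "k > 0" "p ^ k dvd group.ord (alt_group n) g"
  shows "p ^ k \<le> n"
proof -
  obtain ls where ls: "0 \<notin> set ls" "sum_list ls = n" "group.ord (alt_group n) g dvd Lcm (set ls)"
    using alt_group_ord_cycle_lengths[OF assms(1)] by blast
  then have "p ^ k dvd Lcm (set ls)" using assms(4) dvd_trans by blast
  then obtain l where l: "l \<in> set ls" "p ^ k dvd l"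
    using prime_power_dvd_Lcm_nat[of "set ls" p k] ls assms by auto
  then have "p ^ k \<le> l" using ls(1) by (intro dvd_imp_le) (auto intro!: Nat.gr0I)
  also have "l \<le> n" using member_le_sum_list[OF l(1)] ls(2) by simp
  finally show ?thesis .
qed

text \<open>Necessity half of the criterion whose other half is
  \<open>alt_group_squarefree_order\<close>: a product of distinct primes is an element order iff
  their weights fit into n.\<close>

lemma alt_group_primes_dvd_ord:
  assumes "g \<in> carrier (alt_group n)" "finite P"
    "\<And>p. p \<in> P \<Longrightarrow> prime p" "\<And>p. p \<in> P \<Longrightarrow> p dvd group.ord (alt_group n) g"
  shows "sum alt_deg P \<le> n"
proof -
  obtain ls where ls: "0 \<notin> set ls" "sum_list ls = n" "even (length (filter even ls))"
      "group.ord (alt_group n) g dvd Lcm (set ls)"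
    using alt_group_ord_cycle_lengths[OF assms(1)] by blast
  have "\<exists>l\<in>set ls. p dvd l" if "p \<in> P" for p
    using prime_power_dvd_Lcm_nat[of "set ls" p 1] ls that assms(3,4) dvd_trans by auto
  then show ?thesis using sum_alt_deg_le_sum_list[OF assms(2,3) ls(1,3)] ls(2) by simp
qed

section \<open>Construction of elements of squarefree order\<close>

text \<open>Bezout: if p does not divide m, then m x = p y + 1 for some x and y, which would make g
  the identity.\<close>

lemma funpow_prime_eq_id_iff:
  assumes "prime p" "g ^^ p = id" "g \<noteq> id"
  shows "g ^^ m = id \<longleftrightarrow> p dvd m"
proof
  assume m: "g ^^ m = id"
  show "p dvd m"
  proof (rule ccontr)
    assume "\<not> p dvd m"
    moreover from this have "m \<noteq> 0" by (cases m) auto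
    ultimately have "coprime m p" "m \<noteq> 0"
      using prime_imp_coprime[OF assms(1)] by (simp_all add: coprime_commute)
    then obtain x y where xy: "m * x = p * y + 1"
      using bezout_nat[of m p] by auto
    have "g ^^ (m * x) = id" unfolding funpow_mult[symmetric] m by simp
    moreover have "g ^^ (p * y + 1) = g"
      unfolding funpow_add funpow_mult[symmetric] assms(2) by simp
    ultimately show False using xy assms(3) by simp
  qed
next
  assume "p dvd m"
  then obtain k where "m = p * k" by blast
  then show "g ^^ m = id" by (simp add: funpow_mult[symmetric] assms(2))
qed

text \<open>A p-cycle for odd p; for p = 2 the product of two disjoint transpositions, since a
  single one is odd.\<close>

lemma evenperm_prime_order:
  assumes "prime p" "finite X" "card X = alt_deg p"
  shows "\<exists>g. g permutes X \<and> evenperm g \<and> (\<forall>m. g ^^ m = id \<longleftrightarrow> p dvd m)"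
proof -
  obtain cs where cs: "set cs = X" "distinct cs" "length cs = alt_deg p"
    using finite_distinct_list[OF assms(2)] assms(3) distinct_card by metis
  have "\<exists>g. g permutes X \<and> evenperm g \<and> g ^^ p = id \<and> g \<noteq> id"
  proof (cases "p = 2")
    case False
    then have l: "length cs = p" "p \<ge> 2" "odd p"
      using cs(3) prime_odd_nat[OF assms(1)] prime_ge_2_nat[OF assms(1)] by (auto simp: alt_deg_def)
    let ?g = "cycle_of_list cs"
    have "?g \<noteq> id"
    proof
      assume "?g = id"
      \<comment> \<open>Applying the cycle to the entries of its own list rotates the list by one
        place, and a distinct list of length at least 2 is changed by that.\<close>
      then have "rotate1 cs = cs" using cyclic_rotation[OF cs(2), of 1] by simp
      moreover obtain a b xs where ab: "cs = a # b # xs"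
        using l by (cases cs rule: remdups_adj.cases) auto
      ultimately have "b # xs @ [a] = a # b # xs" by simp
      then have "a = b" by simp
      then show False using cs(2) ab by simp
    qed
    moreover have "evenperm ?g" using evenperm_cycle_of_list[OF cs(2)] l by fastforce
    moreover have "?g ^^ p = id" using cycle_is_id_root[OF cs(2)] l by simp
    ultimately show ?thesis using cycle_permutes[of cs] cs(1) by blast
  next
    case True
    then have "length cs = Suc (Suc (Suc (Suc 0)))" using cs(3) by (simp add: alt_deg_def)
    then obtain a b c d where abcd: "cs = [a, b, c, d]"
      unfolding length_Suc_conv by blast
    let ?g = "transpose a b \<circ> transpose c d"
    have ne: "a \<noteq> b" "a \<noteq> c" "a \<noteq> d" "b \<noteq> c" "b \<noteq> d" "c \<noteq> d" and X: "X = {a, b, c, d}"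
      using cs abcd by auto
    have "?g permutes X"
      unfolding X by (rule permutes_compose) (rule permutes_swap_id; simp)+
    moreover have "evenperm ?g"
      using ne evenperm_comp[OF permutation_swap_id permutation_swap_id, of a b c d]
      by (simp add: evenperm_swap del: comp_apply o_apply)
    moreover have "?g ^^ p = id"
    proof -
      have "?g (?g x) = x" for x using ne by (simp add: transpose_def)
      then show ?thesis by (simp add: True numeral_2_eq_2 fun_eq_iff)
    qed
    moreover have "?g a = b" using ne by (simp add: transpose_def)
    then have "?g \<noteq> id" using ne by (metis id_apply)
    ultimately show ?thesis by blast
  qed
  then show ?thesis using funpow_prime_eq_id_iff[OF assms(1)] by blast
qed

text \<open>X is cut into blocks of \<open>alt_deg p\<close> points. Permutations of disjoint blocks
  commute, and their product is the identity only if each of them is, so the divisibility conditions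
  combine.\<close>

lemma evenperm_squarefree_order:
  assumes "finite P" "\<And>p. p \<in> P \<Longrightarrow> prime p" "finite X" "card X = sum alt_deg P"
  shows "\<exists>g. g permutes X \<and> evenperm g \<and> (\<forall>m. g ^^ m = id \<longleftrightarrow> (\<forall>p\<in>P. p dvd m))"
  using assms
proof (induction P arbitrary: X rule: finite_induct)
  case empty
  then show ?case using permutes_id evenperm_id id_funpow by (auto intro!: exI[of _ id] simp del: id_apply)
next
  case (insert p P)
  have "alt_deg p \<le> card X" using insert by simp
  then obtain Y where Y: "Y \<subseteq> X" "card Y = alt_deg p" "finite Y"
    using obtain_subset_with_card_n by blast
  obtain g where g: "g permutes Y" "evenperm g" "\<And>m. g ^^ m = id \<longleftrightarrow> p dvd m"
    using evenperm_prime_order[of p Y] Y insert.prems by auto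
  have "card (X - Y) = sum alt_deg P"
    using Y insert by (simp add: card_Diff_subset)
  then obtain h where h: "h permutes X - Y" "evenperm h" "\<And>m. h ^^ m = id \<longleftrightarrow> (\<forall>p\<in>P. p dvd m)"
    using insert.IH[OF _ _ \<open>card (X - Y) = _\<close>] insert.prems by blast
  have disj: "Y \<inter> (X - Y) = {}" by blast
  have "g \<circ> h permutes X"
    using permutes_subset[OF g(1) Y(1)] permutes_subset[OF h(1), of X]
    by (auto intro: permutes_compose)
  moreover have "evenperm (g \<circ> h)"
    using evenperm_comp[of g h] g h Y insert.prems unfolding permutation_permutes by blast
  moreover have "(g \<circ> h) ^^ m = id \<longleftrightarrow> (\<forall>q\<in>insert p P. q dvd m)" for m
  proof -
    have "(g \<circ> h) ^^ m = g ^^ m \<circ> h ^^ m"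
      by (rule funpow_comp_commute) (rule disjoint_permutes_commute[OF g(1) h(1) disj])
    then have "(g \<circ> h) ^^ m = id \<longleftrightarrow> g ^^ m = id \<and> h ^^ m = id"
      using disjoint_permutes_comp_eq_id[OF permutes_funpow[OF g(1)] permutes_funpow[OF h(1)] disj]
      by metis
    then show ?thesis using g(3) h(3) by simp
  qed
  ultimately show ?case by blast
qed

lemma alt_group_squarefree_order:
  assumes "finite P" "\<And>p. p \<in> P \<Longrightarrow> prime p" "sum alt_deg P \<le> n"
  shows "\<exists>g\<in>carrier (alt_group n). group.ord (alt_group n) g = \<Prod>P"
proof -
  obtain g where g: "g permutes {1..sum alt_deg P}" "evenperm g"
      "\<And>m. g ^^ m = id \<longleftrightarrow> (\<forall>p\<in>P. p dvd m)"
    using evenperm_squarefree_order[OF assms(1,2), of "{1..sum alt_deg P}"] by auto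
  have "g permutes {1..n}" by (rule permutes_subset[OF g(1)]) (use assms(3) in auto)
  then have G: "g \<in> carrier (alt_group n)" using g(2) by (simp add: alt_group_carrier)
  have "group.ord (alt_group n) g dvd m \<longleftrightarrow> \<Prod>P dvd m" for m
    using alt_group_ord_dvd_iff[OF G, of m] g(3) prod_primes_dvd_iff[OF assms(1,2), of m] by simp
  then have "group.ord (alt_group n) g = \<Prod>P" by (meson dvd_antisym dvd_refl)
  then show ?thesis using G by blast
qed

section \<open>The graph in terms of element orders\<close>

text \<open>Merges both alternatives of adjacency into one relation on orders: equal orders are
  realised by g = h.\<close>

definition commuting_orders :: "('a, 'm) monoid_scheme \<Rightarrow> nat \<Rightarrow> nat \<Rightarrow> bool" where
  "commuting_orders G a b \<longleftrightarrow> (\<exists>g\<in>carrier G. \<exists>h\<in>carrier G.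
     group.ord G g = a \<and> group.ord G h = b \<and> g \<otimes>\<^bsub>G\<^esub> h = h \<otimes>\<^bsub>G\<^esub> g)"

lemma commuting_orders_sym: "commuting_orders G a b \<Longrightarrow> commuting_orders G b a"
  unfolding commuting_orders_def by metis

lemma commuting_orders_refl: "g \<in> carrier G \<Longrightarrow> commuting_orders G (group.ord G g) (group.ord G g)"
  unfolding commuting_orders_def by blast

context group
begin

lemma ord_pow_div:
  assumes "finite (carrier G)" "g \<in> carrier G" "d dvd ord g"
  shows "ord (g [^] (ord g div d)) = d"
proof -
  obtain k where k: "ord g = d * k" using assms(3) by blast
  have "ord g \<ge> 1" using ord_ge_1 assms by blast
  then have "d > 0" "k > 0" using k by (auto intro!: Nat.gr0I)
  then show ?thesis using ord_pow[OF assms(2), of k] k by simp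
qed

lemma commuting_orders_dvd:
  assumes "finite (carrier G)" "g \<in> carrier G" "a dvd ord g" "b dvd ord g"
  shows "commuting_orders G a b"
proof -
  let ?x = "g [^] (ord g div a)" and ?y = "g [^] (ord g div b)"
  have "?x \<otimes> ?y = ?y \<otimes> ?x" using assms(2) by (simp add: nat_pow_mult add.commute)
  then show ?thesis
    using ord_pow_div[OF assms(1,2)] assms(2-) unfolding commuting_orders_def by blast
qed

text \<open>The witness is the product gh, of order N. Raising it to the power N b kills h, so a
  divides N b and hence N by coprimality; symmetrically for b.\<close>

lemma commuting_orders_coprime:
  assumes "commuting_orders G a b" "coprime a b"
  shows "\<exists>x\<in>carrier G. a dvd ord x \<and> b dvd ord x"
proof -
  obtain g h where gh: "g \<in> carrier G" "h \<in> carrier G" "ord g = a" "ord h = b" "g \<otimes> h = h \<otimes> g"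
    using assms(1) unfolding commuting_orders_def by blast
  define N where "N = ord (g \<otimes> h)"
  have pow: "g [^] (N * k) \<otimes> h [^] (N * k) = \<one>" for k
  proof -
    have "(g \<otimes> h) [^] (N * k) = \<one>" using gh by (simp add: pow_eq_id N_def)
    then show ?thesis using pow_mult_distrib[OF gh(5,1,2)] by simp
  qed
  have "h [^] (N * b) = \<one>" using gh by (simp add: pow_eq_id)
  then have "g [^] (N * b) = \<one>" using pow[of b] gh by simp
  then have "a dvd N * b" using gh pow_eq_id by blast
  moreover have "g [^] (N * a) = \<one>" using gh by (simp add: pow_eq_id)
  then have "h [^] (N * a) = \<one>" using pow[of a] gh by simp
  then have "b dvd N * a" using gh pow_eq_id by blast
  ultimately have "a dvd N" "b dvd N"
    using assms(2) by (auto simp: coprime_dvd_mult_left_iff coprime_commute)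
  then show ?thesis using gh by (auto simp: N_def)
qed

lemma order_super_commuting_adj_iff:
  assumes "g \<in> carrier G" "h \<in> carrier G"
  shows "order_super_commuting_adj G g h \<longleftrightarrow> g \<noteq> h \<and> commuting_orders G (ord g) (ord h)"
  using commuting_orders_refl[OF assms(1)] assms
  unfolding order_super_commuting_adj_def commuting_orders_def by metis

lemma verts_reduced_graph:
  "v \<in> verts (reduced_order_super_commuting_graph G) \<longleftrightarrow>
     v \<in> carrier G \<and> (\<exists>u\<in>carrier G. \<not> commuting_orders G (ord v) (ord u))"
  using commuting_orders_refl[of v G]
  by (auto simp: reduced_order_super_commuting_graph_def order_super_commuting_graph_def Let_def
      dominant_vertex_def order_super_commuting_adj_iff)

lemma verts_reduced_graph_ord_neq_1:
  assumes "finite (carrier G)" "v \<in> verts (reduced_order_super_commuting_graph G)"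
  shows "ord v \<noteq> 1"
proof
  assume "ord v = 1"
  then have "commuting_orders G (ord v) (ord u)" if "u \<in> carrier G" for u
    using commuting_orders_dvd[OF assms(1) that, of 1 "ord u"] by simp
  then show False using assms(2) by (auto simp: verts_reduced_graph)
qed

lemma arcs_reduced_graph:
  "(u, v) \<in> arcs (reduced_order_super_commuting_graph G) \<longleftrightarrow>
     u \<in> verts (reduced_order_super_commuting_graph G) \<and> v \<in> verts (reduced_order_super_commuting_graph G) \<and>
     u \<noteq> v \<and> commuting_orders G (ord u) (ord v)"
proof -
  have "u \<in> carrier G" if "u \<in> verts (reduced_order_super_commuting_graph G)" for u
    using that by (simp add: verts_reduced_graph)
  then show ?thesis
    by (auto simp: reduced_order_super_commuting_graph_def order_super_commuting_graph_def Let_def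
      order_super_commuting_adj_iff)
qed

lemma tail_head_reduced_graph:
  "tail (reduced_order_super_commuting_graph G) = fst" "head (reduced_order_super_commuting_graph G) = snd"
  by (simp_all add: reduced_order_super_commuting_graph_def order_super_commuting_graph_def Let_def)

lemma wf_digraph_reduced_graph: "wf_digraph (reduced_order_super_commuting_graph G)"
  by unfold_locales (auto simp: tail_head_reduced_graph arcs_reduced_graph)

text \<open>Length 0 is for u = v, so that vertices of the paths built later may coincide.\<close>

lemma awalk_reduced_graph:
  assumes "u \<in> verts (reduced_order_super_commuting_graph G)" "v \<in> verts (reduced_order_super_commuting_graph G)"
    "commuting_orders G (ord u) (ord v)"
  shows "\<exists>p. pre_digraph.awalk (reduced_order_super_commuting_graph G) u p v \<and> length p \<le> 1"
proof (cases "u = v")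
  case True
  then show ?thesis using assms by (intro exI[of _ "[]"]) (simp add: pre_digraph.awalk_def pre_digraph.cas.simps)
next
  case False
  then show ?thesis using assms
    by (intro exI[of _ "[(u, v)]"])
      (simp add: pre_digraph.awalk_def pre_digraph.cas.simps arcs_reduced_graph tail_head_reduced_graph)
qed

lemma graph_dist_reduced_graph_le_3:
  assumes "{u, x, y, v} \<subseteq> verts (reduced_order_super_commuting_graph G)"
    "commuting_orders G (ord u) (ord x)" "commuting_orders G (ord x) (ord y)" "commuting_orders G (ord y) (ord v)"
  shows "graph_dist (reduced_order_super_commuting_graph G) u v \<le> 3"
proof -
  interpret H: wf_digraph "reduced_order_super_commuting_graph G" by (rule wf_digraph_reduced_graph)
  obtain p q r where w: "H.awalk u p x" "H.awalk x q y" "H.awalk y r v"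
      and l: "length p \<le> 1" "length q \<le> 1" "length r \<le> 1"
    using awalk_reduced_graph assms by (metis insert_subset)
  have w: "H.awalk u (p @ q @ r) v" by (rule H.awalk_appendI[OF w(1) H.awalk_appendI[OF w(2,3)]])
  have "H.awalk_cost (\<lambda>_. 1) xs = real (length xs)" for xs
    by (induction xs) simp_all
  then have "H.\<mu> (\<lambda>_. 1) u v \<le> ereal (real (length (p @ q @ r)))"
    using H.min_cost_le_walk_cost[OF w, of "\<lambda>_. 1"] by simp
  also have "\<dots> \<le> 3" using l by simp
  finally show ?thesis by (simp add: graph_dist_def)
qed

text \<open>Serves to refute connectedness, by a property that spreads along edges but does not hold
  at every vertex.\<close>

lemma connected_reduced_graph_closed:
  assumes conn: "Digraph_Component.connected (reduced_order_super_commuting_graph G)"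
    and step: "\<And>u v. u \<in> verts (reduced_order_super_commuting_graph G) \<Longrightarrow>
      v \<in> verts (reduced_order_super_commuting_graph G) \<Longrightarrow>
      commuting_orders G (ord u) (ord v) \<Longrightarrow> Q u \<Longrightarrow> Q v"
    and u: "u \<in> verts (reduced_order_super_commuting_graph G)" "Q u"
    and v: "v \<in> verts (reduced_order_super_commuting_graph G)"
  shows "Q v"
proof -
  interpret H: wf_digraph "reduced_order_super_commuting_graph G" by (rule wf_digraph_reduced_graph)
  have "(u, v) \<in> rtrancl_on (verts (reduced_order_super_commuting_graph G))
      ((arcs_ends (reduced_order_super_commuting_graph G))\<^sup>s)"
    using conn u v by (simp add: connected_conv)
  then show ?thesis
  proof (induction rule: rtrancl_on_induct)
    case (step y z)
    \<comment> \<open>Connectedness refers to the symmetric closure of the arcs, so either direction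
      may occur.\<close>
    then have "(y, z) \<in> arcs (reduced_order_super_commuting_graph G) \<or> (z, y) \<in> arcs (reduced_order_super_commuting_graph G)"
      by (auto simp: arcs_ends_def arc_to_ends_def tail_head_reduced_graph symcl_def)
    then have "y \<in> verts (reduced_order_super_commuting_graph G)"
        "z \<in> verts (reduced_order_super_commuting_graph G)" "commuting_orders G (ord y) (ord z)"
      using commuting_orders_sym unfolding arcs_reduced_graph by blast+
    then show ?case using assms(2) step.IH by blast
  qed (rule u)
qed

end

section \<open>Alternating groups\<close>

text \<open>Coprimality merges the commuting pair into a single element whose order is divisible by
  all of P.\<close>

lemma alt_group_commuting_orders_sum_le:
  assumes "commuting_orders (alt_group n) a b" "coprime a b" "finite P"
    "\<And>p. p \<in> P \<Longrightarrow> prime p" "\<And>p. p \<in> P \<Longrightarrow> p dvd a \<or> p dvd b"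
  shows "sum alt_deg P \<le> n"
proof -
  obtain x where x: "x \<in> carrier (alt_group n)"
      "a dvd group.ord (alt_group n) x" "b dvd group.ord (alt_group n) x"
    using group.commuting_orders_coprime[OF alt_group_is_group assms(1,2)] by blast
  show ?thesis
    by (rule alt_group_primes_dvd_ord[OF x(1) assms(3,4)]) (use x assms(5) dvd_trans in blast)+
qed

lemma alt_group_commuting_primes:
  assumes "prime p" "prime q" "p \<noteq> q" "alt_deg p + alt_deg q \<le> n"
  shows "commuting_orders (alt_group n) p q"
proof -
  obtain g where g: "g \<in> carrier (alt_group n)" "group.ord (alt_group n) g = \<Prod>{p, q}"
    using alt_group_squarefree_order[of "{p, q}" n] assms by auto
  then show ?thesis
    using group.commuting_orders_dvd[OF alt_group_is_group alt_group_finite g(1), of p q] assms(3)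
    by simp
qed

lemma alt_group_prime_order_in_verts:
  assumes "n \<ge> 4" "v \<in> carrier (alt_group n)" "prime (group.ord (alt_group n) v)"
  shows "v \<in> verts (reduced_order_super_commuting_graph (alt_group n))"
proof -
  let ?r = "group.ord (alt_group n) v"
  obtain Q where Q: "finite Q" "\<And>p. p \<in> Q \<Longrightarrow> prime p" "?r \<notin> Q" "sum alt_deg Q \<le> n"
      "n < sum alt_deg Q + alt_deg ?r"
    using prime_sum_window[OF assms(3,1)] by blast
  obtain w where w: "w \<in> carrier (alt_group n)" "group.ord (alt_group n) w = \<Prod>Q"
    using alt_group_squarefree_order[OF Q(1,2,4)] by blast
  have "\<not> commuting_orders (alt_group n) ?r (\<Prod>Q)"
  proof
    assume co: "commuting_orders (alt_group n) ?r (\<Prod>Q)"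
    have "coprime ?r (\<Prod>Q)"
      by (rule prod_coprime_right) (use Q(2,3) assms(3) in \<open>auto intro!: primes_coprime\<close>)
    then have "sum alt_deg (insert ?r Q) \<le> n"
      by (rule alt_group_commuting_orders_sum_le[OF co])
        (use Q(1,2) assms(3) in \<open>auto intro: dvd_prodI\<close>)
    then show False using Q by simp
  qed
  then show ?thesis
    unfolding group.verts_reduced_graph[OF alt_group_is_group] using w assms(2) by metis
qed

text \<open>A second prime divisor is at least p and would require more than n points together with
  p; a factor \<open>p ^ 2\<close> would give 2p \<le> \<open>p ^ 2\<close> \<le> n.\<close>

lemma alt_group_large_minimal_prime:
  assumes "n \<ge> 8" "u \<in> carrier (alt_group n)" "prime p" "p dvd group.ord (alt_group n) u"
    and min: "\<And>q. prime q \<Longrightarrow> q dvd group.ord (alt_group n) u \<Longrightarrow> p \<le> q"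
    and large: "n < 2 * alt_deg p"
  shows "group.ord (alt_group n) u = p"
proof (rule ccontr)
  \<comment> \<open>For p = 2 the bound \<open>large\<close> would read n < 8.\<close>
  have p2: "p \<noteq> 2" and p: "alt_deg p = p" "n < 2 * p"
    using assms(1) large by (auto simp: alt_deg_def split: if_splits)
  obtain k where k: "group.ord (alt_group n) u = p * k" using assms(4) by blast
  assume "group.ord (alt_group n) u \<noteq> p"
  then have "k \<noteq> 1" using k by auto
  then obtain q where q: "prime q" "q dvd k" using prime_factor_nat by blast
  show False
  proof (cases "q = p")
    case True
    then have "p ^ 2 dvd group.ord (alt_group n) u" using q k by (simp add: power2_eq_square)
    then have "p ^ 2 \<le> n" by (intro alt_group_prime_power_dvd_ord[OF assms(2,3)]) simp_all
    moreover have "2 * p \<le> p ^ 2" using prime_ge_2_nat[OF assms(3)] by (simp add: power2_eq_square)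
    ultimately show False using p by linarith
  next
    case False
    have qd: "q dvd group.ord (alt_group n) u" using q k by simp
    have "sum alt_deg {p, q} \<le> n"
      by (rule alt_group_primes_dvd_ord[OF assms(2)]) (use q qd assms(3,4) in auto)
    moreover have "p \<le> alt_deg q" using min[OF q(1) qd] alt_deg_ge[of q] by linarith
    ultimately show False using False p by simp
  qed
qed

lemma alt_group_path_of_primes:
  assumes n: "n \<ge> 10" "\<not> prime n" "\<not> prime (n - 1)" "\<not> prime (n - 2)"
    and u: "u \<in> carrier (alt_group n)" "group.ord (alt_group n) u \<noteq> 1"
    and v: "v \<in> carrier (alt_group n)" "group.ord (alt_group n) v \<noteq> 1"
  shows "\<exists>a b. prime a \<and> prime b \<and> commuting_orders (alt_group n) (group.ord (alt_group n) u) a \<and>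
    commuting_orders (alt_group n) a b \<and> commuting_orders (alt_group n) b (group.ord (alt_group n) v)"
proof -
  let ?C = "commuting_orders (alt_group n)" and ?o = "group.ord (alt_group n)"
  have min_prime: "\<exists>p. prime p \<and> p dvd ?o w \<and> (\<forall>q. prime q \<longrightarrow> q dvd ?o w \<longrightarrow> p \<le> q)"
    if "?o w \<noteq> 1" for w
  proof -
    have ex: "\<exists>p. prime p \<and> p dvd ?o w" using that prime_factor_nat by blast
    define p where "p = (LEAST p. prime p \<and> p dvd ?o w)"
    have "prime p \<and> p dvd ?o w" unfolding p_def by (rule LeastI_ex[OF ex])
    moreover have "p \<le> q" if "prime q" "q dvd ?o w" for q
      unfolding p_def by (rule Least_le) (use that in simp)
    ultimately show ?thesis by blast
  qed
  obtain p where p: "prime p" "p dvd ?o u" "\<And>q. prime q \<Longrightarrow> q dvd ?o u \<Longrightarrow> p \<le> q"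
    using min_prime[OF u(2)] by blast
  obtain q where q: "prime q" "q dvd ?o v" "\<And>p. prime p \<Longrightarrow> p dvd ?o v \<Longrightarrow> q \<le> p"
    using min_prime[OF v(2)] by blast
  have Cdvd: "?C (?o w) r" if "w \<in> carrier (alt_group n)" "r dvd ?o w" for w r
    using group.commuting_orders_dvd[OF alt_group_is_group alt_group_finite that(1) dvd_refl that(2)] .
  have Cdvd2: "?C r r" if "w \<in> carrier (alt_group n)" "r dvd ?o w" for w r
    using group.commuting_orders_dvd[OF alt_group_is_group alt_group_finite that(1) that(2) that(2)] .
  \<comment> \<open>A 3-cycle fits beside an element of order r: this is where the three numbers n,
    n - 1, n - 2 must not be prime.\<close>
  have le: "alt_deg r + 3 \<le> n" if "w \<in> carrier (alt_group n)" "prime r" "r dvd ?o w" for w r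
  proof (cases "r = 2")
    case False
    have "sum alt_deg {r} \<le> n" by (rule alt_group_primes_dvd_ord[OF that(1)]) (use that in auto)
    then have "r \<le> n" using alt_deg_ge[of r] by simp
    moreover have "r \<noteq> n" "r \<noteq> n - 1" "r \<noteq> n - 2" using n that by auto
    ultimately show ?thesis using False by (simp add: alt_deg_def)
  qed (use n in \<open>simp add: alt_deg_def\<close>)
  \<comment> \<open>If the weights of p and q do not fit together, the larger one exceeds n / 2, so
    x has order p itself and the path runs through orders 3 and q. The claim is kept general in x
    and y to allow swapping u and v.\<close>
  have via_3: "\<exists>a b. prime a \<and> prime b \<and> ?C (?o x) a \<and> ?C a b \<and> ?C b (?o y)"
    if x: "x \<in> carrier (alt_group n)" "prime p" "p dvd ?o x" "\<And>q. prime q \<Longrightarrow> q dvd ?o x \<Longrightarrow> p \<le> q"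
      and y: "y \<in> carrier (alt_group n)" "prime q" "q dvd ?o y"
      and pq: "n < alt_deg p + alt_deg q" "alt_deg q \<le> alt_deg p" for x y p q
  proof -
    have large: "n < 2 * alt_deg p" using pq by linarith
    have op: "?o x = p" by (rule alt_group_large_minimal_prime[OF _ x large]) (use n in auto)
    have "prime (3::nat)" by simp
    have "p \<noteq> 3" using large n by (auto simp: alt_deg_def)
    \<comment> \<open>Order 3 does fit beside p, whereas q does not.\<close>
    have "q \<noteq> 3" using pq le[OF x(1-3)] by (auto simp: alt_deg_def)
    have "?C p 3" by (rule alt_group_commuting_primes)
      (use x le[OF x(1-3)] \<open>p \<noteq> 3\<close> \<open>prime 3\<close> in \<open>auto simp: alt_deg_def\<close>)
    moreover have "?C 3 q" by (rule alt_group_commuting_primes)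
      (use y le[OF y] \<open>q \<noteq> 3\<close> \<open>prime 3\<close> in \<open>auto simp: alt_deg_def\<close>)
    moreover have "?C q (?o y)" using Cdvd[OF y(1,3)] by (rule commuting_orders_sym)
    ultimately show ?thesis using op y(2) \<open>prime 3\<close>
      by (intro exI[of _ 3] exI[of _ q]) simp
  qed
  consider "p = q" | "p \<noteq> q" "alt_deg p + alt_deg q \<le> n"
    | "n < alt_deg p + alt_deg q" "alt_deg q \<le> alt_deg p" | "n < alt_deg q + alt_deg p" "alt_deg p \<le> alt_deg q"
    by (metis add.commute linorder_not_le nat_le_linear)
  then show ?thesis
  proof cases
    case 1
    show ?thesis
      using p(1) q(1) Cdvd[OF u(1) p(2)] Cdvd2[OF u(1) p(2)] commuting_orders_sym[OF Cdvd[OF v(1) q(2)]]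
      unfolding 1 by (intro exI[of _ q]) simp
  next
    case 2
    show ?thesis
      using p(1) q(1) Cdvd[OF u(1) p(2)] alt_group_commuting_primes[OF p(1) q(1) 2]
        commuting_orders_sym[OF Cdvd[OF v(1) q(2)]] by (intro exI[of _ p] exI[of _ q]) simp
  next
    case 3
    show ?thesis by (rule via_3[OF u(1) p v(1) q(1,2) 3])
  next
    case 4
    from via_3[OF v(1) q u(1) p(1,2) 4] obtain a b where ab: "prime a" "prime b"
        "?C (?o v) a" "?C a b" "?C b (?o u)" by blast
    then show ?thesis
      using ab(3-)[THEN commuting_orders_sym] by (intro exI[of _ b] exI[of _ a]) simp
  qed
qed

section \<open>The disconnected cases\<close>

text \<open>Beside p at most 2 points remain, too few for another prime, and \<open>p ^ 2\<close>
  exceeds n; so b has no other prime divisor and no second factor p.\<close>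

lemma alt_group_isolated_prime:
  assumes "prime p" "p \<ge> 3" "n \<le> p + 2" "commuting_orders (alt_group n) p b" "b \<noteq> 1"
  shows "b = p"
proof (rule ccontr)
  assume "b \<noteq> p"
  obtain g h where gh: "g \<in> carrier (alt_group n)" "h \<in> carrier (alt_group n)"
      "group.ord (alt_group n) g = p" "group.ord (alt_group n) h = b"
      "g \<otimes>\<^bsub>alt_group n\<^esub> h = h \<otimes>\<^bsub>alt_group n\<^esub> g"
    using assms(4) unfolding commuting_orders_def by blast
  show False
  proof (cases "\<exists>q. prime q \<and> q dvd b \<and> q \<noteq> p")
    case True
    then obtain q where q: "prime q" "q dvd b" "q \<noteq> p" by blast
    \<comment> \<open>Passing to a power of h makes the second order a prime q, coprime to
      p.\<close>
    let ?h = "h [^]\<^bsub>alt_group n\<^esub> (b div q)"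
    interpret group "alt_group n" by (rule alt_group_is_group)
    have "ord ?h = q" using ord_pow_div[OF alt_group_finite gh(2), of q] gh(4) q(2) by simp
    moreover have "g \<otimes>\<^bsub>alt_group n\<^esub> ?h = ?h \<otimes>\<^bsub>alt_group n\<^esub> g"
      by (rule group_commutes_pow[OF gh(5)[symmetric] gh(2,1), symmetric])
    ultimately have co: "commuting_orders (alt_group n) p q"
      using gh unfolding commuting_orders_def by blast
    have "sum alt_deg {p, q} \<le> n"
      by (rule alt_group_commuting_orders_sum_le[OF co])
        (use assms(1) q primes_coprime[of p q] in blast, simp, use assms(1) q(1) in auto)
    \<comment> \<open>The weight 4 of the prime 2 matters here: a weight of 2 would fit into p + 2
      points.\<close>
    moreover have "alt_deg q \<ge> 3" using prime_ge_2_nat[OF q(1)] by (auto simp: alt_deg_def)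
    moreover have "sum alt_deg {p, q} = alt_deg p + alt_deg q" using q(3) by simp
    ultimately show False using alt_deg_ge[of p] assms(3) by linarith
  next
    case False
    obtain q where "prime q" "q dvd b" using assms(5) prime_factor_nat by blast
    then have "p dvd b" using False by blast
    then obtain k where k: "b = p * k" by blast
    then have "k \<noteq> 1" using \<open>b \<noteq> p\<close> by auto
    then obtain q where "prime q" "q dvd k" using prime_factor_nat by blast
    then have "p dvd k" using False k by (metis dvd_mult)
    then have "p ^ 2 dvd group.ord (alt_group n) h" using k gh by (simp add: power2_eq_square)
    then have "p ^ 2 \<le> n" by (rule alt_group_prime_power_dvd_ord[OF gh(2) assms(1), rotated]) simp
    moreover have "3 * p \<le> p ^ 2" using assms(2) by (simp add: power2_eq_square)
    ultimately show False using assms(2,3) by linarith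
  qed
qed

text \<open>Having order p spreads along edges, yet some vertices have order 2: both orders are
  prime, hence not dominant.\<close>

lemma not_connected_of_large_prime:
  assumes "prime p" "p \<ge> 3" "p \<le> n" "n \<le> p + 2" "n \<ge> 4"
  shows "\<not> Digraph_Component.connected (reduced_order_super_commuting_graph (alt_group n))"
proof
  let ?G = "alt_group n"
  interpret group ?G by (rule alt_group_is_group)
  assume conn: "Digraph_Component.connected (reduced_order_super_commuting_graph ?G)"
  have "alt_deg p \<le> n" "alt_deg 2 \<le> n" using assms(2,3,5) by (simp_all add: alt_deg_def)
  then obtain g h where g: "g \<in> carrier ?G" "ord g = p" and h: "h \<in> carrier ?G" "ord h = 2"
    using alt_group_squarefree_order[of "{p}" n] alt_group_squarefree_order[of "{2}" n] assms(1) by auto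
  have gv: "g \<in> verts (reduced_order_super_commuting_graph ?G)"
    by (rule alt_group_prime_order_in_verts[OF assms(5) g(1)]) (simp add: g(2) assms(1))
  have hv: "h \<in> verts (reduced_order_super_commuting_graph ?G)"
    by (rule alt_group_prime_order_in_verts[OF assms(5) h(1)]) (simp add: h(2))
  have step: "ord y = p" if "y \<in> verts (reduced_order_super_commuting_graph ?G)"
      "commuting_orders ?G (ord x) (ord y)" "ord x = p" for x y
    using alt_group_isolated_prime[OF assms(1,2,4), of "ord y"]
      verts_reduced_graph_ord_neq_1[OF alt_group_finite that(1)] that(2,3) by simp
  have "ord h = p"
    using connected_reduced_graph_closed[where Q = "\<lambda>x. ord x = p", OF conn _ gv g(2) hv] step by blast
  then show False using h(2) assms(2) by simp
qed

theorem theorem4p17: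
  fixes n :: nat
  assumes "n \<ge> 4"
    and "Digraph_Component.connected (reduced_order_super_commuting_graph (alt_group n))"
  shows "diameter (reduced_order_super_commuting_graph (alt_group n)) \<le> 3"
proof -
  let ?H = "reduced_order_super_commuting_graph (alt_group n)"
  interpret group "alt_group n" by (rule alt_group_is_group)
  have np: "\<not> prime p" if "3 \<le> p" "p \<le> n" "n \<le> p + 2" for p
    using not_connected_of_large_prime[of p n, OF _ that assms(1)] assms(2) by blast
  have n10: "n \<ge> 10"
  proof (rule ccontr)
    assume "\<not> ?thesis"
    \<comment> \<open>Each n from 4 to 9 exceeds one of the primes 3, 5, 7 by at most 2.\<close>
    then consider "n \<le> 5" | "5 \<le> n" "n \<le> 7" | "7 \<le> n" "n \<le> 9" by linarith
    then show False
    proof cases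
      case 1
      then show ?thesis using np[of 3] assms(1) by simp
    next
      case 2
      then show ?thesis using np[of 5] by simp
    next
      case 3
      then show ?thesis using np[of 7] by simp
    qed
  qed
  have "graph_dist ?H u v \<le> 3" if uv: "u \<in> verts ?H" "v \<in> verts ?H" for u v
  proof -
    have c: "u \<in> carrier (alt_group n)" "v \<in> carrier (alt_group n)"
      using uv by (auto simp: verts_reduced_graph)
    have o: "ord u \<noteq> 1" "ord v \<noteq> 1"
      using verts_reduced_graph_ord_neq_1[OF alt_group_finite] uv by blast+
    have np': "\<not> prime n" "\<not> prime (n - 1)" "\<not> prime (n - 2)"
      by (rule np; use n10 in simp)+
    obtain a b where ab: "prime a" "prime b" "commuting_orders (alt_group n) (ord u) a"
        "commuting_orders (alt_group n) a b" "commuting_orders (alt_group n) b (ord v)"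
      using alt_group_path_of_primes[OF n10 np' c(1) o(1) c(2) o(2)] by blast
    obtain x where x: "x \<in> carrier (alt_group n)" "ord x = a"
      using ab(4) unfolding commuting_orders_def by blast
    obtain y where y: "y \<in> carrier (alt_group n)" "ord y = b"
      using ab(4) unfolding commuting_orders_def by blast
    \<comment> \<open>The intermediate vertices survive the deletion of dominant vertices because
      their orders are prime.\<close>
    have "x \<in> verts ?H" "y \<in> verts ?H"
      using alt_group_prime_order_in_verts[OF assms(1)] x y ab(1,2) by simp_all
    then show ?thesis
      using graph_dist_reduced_graph_le_3[of u x y v] uv x y ab by simp
  qed
  then show ?thesis unfolding diameter_def by (intro SUP_least)
qed

end
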